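(* Let $\mathcal P$ be a smooth manifold, let $o\in\mathcal P$, and let $A$ and $M$ be symmetric idempotent maps of class $C^2$ from an open neighborhood $\mathcal W$ of $(o,o)$ in $\mathcal P\times\mathcal P$ to $\mathcal P$. Write $T(X,Y):=(A(X,Y),M(X,Y))$. Fix a coordinate chart around $o$ and write $|\cdot|$ for the coordinate norm. Then there exist a compact set $\mathcal K$ (in the chart domain) with $\mathcal K\times\mathcal K\subset\mathcal W$, an open neighborhood $\mathcal U\subset\mathcal K$ of $o$, an open set $\mathcal D\subset\mathcal P\times\mathcal P$ invariant under $(X,Y)\mapsto(Y,X)$ with $T(\mathcal D)\subset\mathcal D\subset\mathcal K\times\mathcal K$, and constants $\varepsilon>0$ and $C>0$, such that $$\Omega_\varepsilon:=\{(X,Y)\in\mathcal U\times\mathcal U:\ |X-Y|<\varepsilon\}\subset\mathcal D$$ and the following hold. For every $(P_0,Q_0)\in\mathcal D$, with $(P_{n+1},Q_{n+1}):=T(P_n,Q_n)$ and $\delta_n:=|P_n-Q_n|$: (1) $(P_n,Q_n)\in\mathcal D$ and $\delta_{n+1}\le C\delta_n^2\le\frac12\delta_n$ for every $n\ge0$; (2) there exists $L(P_0,Q_0)\in\mathcal K$ such that $|P_n-L(P_0,Q_0)|\le2\delta_n$ and $|Q_n-L(P_0,Q_0)|\le3\delta_n$ for every $n\ge0$; in particular the Gauss composition $(A\otimes M)(P_0,Q_0)=L(P_0,Q_0)$ is defined. Moreover, the map $L=A\otimes M$ is continuous, symmetric, and idempotent on $\mathcal D$, and (3) $\displaystyle\left|L(X,Y)-\frac{A(X,Y)+M(X,Y)}{2}\right|\le\frac23C^3|X-Y|^4$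 for every $(X,Y)\in\mathcal D$.
   Context: A map $N$ from a subset of $\mathcal P\times\mathcal P$ to $\mathcal P$ is symmetric if $N(X,Y)=N(Y,X)$ and idempotent if $N(X,X)=X$, whenever both sides are defined. Points of the chart domain are identified with their coordinate vectors, so that differences, sums, and norms of points are taken in coordinates. The Gauss composition $(A\otimes M)(P_0,Q_0)$ is the common limit of the sequences $(P_n)$ and $(Q_n)$ when both converge to the same point. No metric or connection is assumed. *)

theory Defs
  imports "HOL-Analysis.Analysis"
begin

section \<open>Maps of class \<open>C\<^sup>k\<close> between smooth manifolds\<close>

text \<open>
  Meant for open \<open>S\<close> in a finite-dimensional space. There, continuity of the derivative is the
  same as continuity of all its directional derivatives, which keeps the recursion within one type.
\<close>

primrec Ck_on :: "nat \<Rightarrow> 'a::real_normed_vector set \<Rightarrow> ('a \<Rightarrow> 'b::real_normed_vector) \<Rightarrow> bool" where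
  "Ck_on 0 S f \<longleftrightarrow> continuous_on S f"
| "Ck_on (Suc k) S f \<longleftrightarrow>
     (\<forall>x\<in>S. f differentiable (at x)) \<and>
     (\<forall>v. Ck_on k S (\<lambda>x. frechet_derivative f (at x) v))"

definition smooth_on :: "'a::real_normed_vector set \<Rightarrow> ('a \<Rightarrow> 'b::real_normed_vector) \<Rightarrow> bool" where
  "smooth_on S f \<longleftrightarrow> (\<forall>k. Ck_on k S f)"

text \<open>
  A chart is a pair of its domain and its coordinate map; the values of the coordinate map outside
  the domain are irrelevant.
\<close>

type_synonym ('p, 'e) chart = "'p set \<times> ('p \<Rightarrow> 'e)"

definition is_chart :: "('p::topological_space, 'e::real_inner) chart \<Rightarrow> bool" where
  "is_chart c \<longleftrightarrow> (case c of (U, \<phi>) \<Rightarrow>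
     open U \<and> open (\<phi> ` U) \<and> homeomorphism U (\<phi> ` U) \<phi> (inv_into U \<phi>))"

definition smoothly_compatible ::
    "('p::topological_space, 'e::real_inner) chart \<Rightarrow> ('p, 'e) chart \<Rightarrow> bool" where
  "smoothly_compatible c d \<longleftrightarrow> (case (c, d) of ((U, \<phi>), (V, \<psi>)) \<Rightarrow>
     smooth_on (\<phi> ` (U \<inter> V)) (\<psi> \<circ> inv_into U \<phi>) \<and>
     smooth_on (\<psi> ` (U \<inter> V)) (\<phi> \<circ> inv_into V \<psi>))"

text \<open>
  The manifold is the whole type \<open>'p\<close>, modelled on the finite-dimensional inner product
  space \<open>'e\<close>. Unlike \<^class>\<open>euclidean_space\<close>, the spanning-set condition admits dimension \<open>0\<close>.
\<close>

definition smooth_manifold ::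
    "('p::{t2_space, second_countable_topology}, 'e::real_inner) chart set \<Rightarrow> bool" where
  "smooth_manifold \<A> \<longleftrightarrow>
     (\<exists>B::'e set. finite B \<and> span B = UNIV) \<and>
     (\<forall>c\<in>\<A>. is_chart c) \<and>
     (\<Union>c\<in>\<A>. fst c) = UNIV \<and>
     (\<forall>c\<in>\<A>. \<forall>d\<in>\<A>. smoothly_compatible c d)"

text \<open>The maximal atlas: all coordinate charts of the manifold given by the atlas \<open>\<A>\<close>.\<close>

definition coordinate_charts ::
    "('p::topological_space, 'e::real_inner) chart set \<Rightarrow> ('p, 'e) chart set" where
  "coordinate_charts \<A> = {c. is_chart c \<and> (\<forall>d\<in>\<A>. smoothly_compatible c d)}"

definition product_atlas :: "('p, 'e) chart set \<Rightarrow> ('q, 'f) chart set \<Rightarrow> ('p \<times> 'q, 'e \<times> 'f) chart set" where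
  "product_atlas \<A> \<B> = {(U \<times> V, map_prod \<phi> \<psi>) | U \<phi> V \<psi>. (U, \<phi>) \<in> \<A> \<and> (V, \<psi>) \<in> \<B>}"

text \<open>
  Continuity of \<open>F\<close> makes the domain of each coordinate representation open; by compatibility it
  is enough to test the charts of the given atlases.
\<close>

definition Ck_map ::
    "nat \<Rightarrow> ('p::topological_space, 'e::real_inner) chart set \<Rightarrow>
     ('q::topological_space, 'f::real_inner) chart set \<Rightarrow> 'p set \<Rightarrow> ('p \<Rightarrow> 'q) \<Rightarrow> bool" where
  "Ck_map k \<A> \<B> W F \<longleftrightarrow>
     continuous_on W F \<and>
     (\<forall>(U, \<phi>)\<in>\<A>. \<forall>(V, \<psi>)\<in>\<B>. Ck_on k (\<phi> ` (W \<inter> U \<inter> F -` V)) (\<psi> \<circ> F \<circ> inv_into U \<phi>))"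

section \<open>Means and their Gauss composition\<close>

text \<open>
  A partial map on \<open>'p \<times> 'p\<close> is a total function together with its domain \<open>W\<close>.
\<close>

definition symmetric_on :: "('p \<times> 'p) set \<Rightarrow> ('p \<times> 'p \<Rightarrow> 'p) \<Rightarrow> bool" where
  "symmetric_on W N \<longleftrightarrow> (\<forall>X Y. (X, Y) \<in> W \<and> (Y, X) \<in> W \<longrightarrow> N (X, Y) = N (Y, X))"

definition idempotent_on :: "('p \<times> 'p) set \<Rightarrow> ('p \<times> 'p \<Rightarrow> 'p) \<Rightarrow> bool" where
  "idempotent_on W N \<longleftrightarrow> (\<forall>X. (X, X) \<in> W \<longrightarrow> N (X, X) = X)"

definition gauss_step :: "('p \<times> 'p \<Rightarrow> 'p) \<Rightarrow> ('p \<times> 'p \<Rightarrow> 'p) \<Rightarrow> 'p \<times> 'p \<Rightarrow> 'p \<times> 'p" where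
  "gauss_step A M z = (A z, M z)"

definition gauss_iterate ::
    "('p \<times> 'p \<Rightarrow> 'p) \<Rightarrow> ('p \<times> 'p \<Rightarrow> 'p) \<Rightarrow> 'p \<times> 'p \<Rightarrow> nat \<Rightarrow> 'p \<times> 'p" where
  "gauss_iterate A M z n = (gauss_step A M ^^ n) z"

text \<open>The iterates must stay in \<open>W\<close>, since only there the means \<open>A\<close> and \<open>M\<close> are defined.\<close>

definition has_gauss_composition ::
    "('p::topological_space \<times> 'p) set \<Rightarrow> ('p \<times> 'p \<Rightarrow> 'p) \<Rightarrow> ('p \<times> 'p \<Rightarrow> 'p) \<Rightarrow> 'p \<times> 'p \<Rightarrow> 'p \<Rightarrow> bool" where
  "has_gauss_composition W A M z l \<longleftrightarrow>
     (\<forall>n. gauss_iterate A M z n \<in> W) \<and>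
     (\<lambda>n. fst (gauss_iterate A M z n)) \<longlonglongrightarrow> l \<and>
     (\<lambda>n. snd (gauss_iterate A M z n)) \<longlonglongrightarrow> l"

definition gauss_composition ::
    "('p::t2_space \<times> 'p) set \<Rightarrow> ('p \<times> 'p \<Rightarrow> 'p) \<Rightarrow> ('p \<times> 'p \<Rightarrow> 'p) \<Rightarrow> 'p \<times> 'p \<Rightarrow> 'p" where
  "gauss_composition W A M z = (THE l. has_gauss_composition W A M z l)"

end

theory Submission
  imports Defs
begin

text \<open>
  The heart of the matter is one estimate in coordinates: a symmetric idempotent \<open>C\<^sup>2\<close> mean agrees
  with the arithmetic midpoint up to an error quadratic in the distance of its arguments. Expand
  the coordinate form \<open>F\<close> around \<open>(m, m)\<close>, where \<open>m\<close> is the midpoint of \<open>x = m + h\<close> and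
  \<open>y = m - h\<close>. The values at \<open>(m + h, m - h)\<close> and \<open>(m - h, m + h)\<close> coincide by symmetry, while their
  first-order terms are opposite; averaging leaves \<open>F (m, m) = m\<close> plus a second-order remainder.
  So only a bound on symmetric second differences is needed (\<open>C2_midpoint_defect\<close>). It transfers
  from an atlas chart to the given chart, since a transition map is locally Lipschitz and
  has a quadratic midpoint defect of its own (\<open>mean_near_midpoint\<close>).

  Choose \<open>C\<close> so that near the base point both means lie within \<open>(C/2) \<delta>\<^sup>2\<close> of the midpoint, \<open>\<delta>\<close> being
  the gap of the arguments. One step of the iteration then turns the gap into at most \<open>C \<delta>\<^sup>2\<close>, which is
  at most \<open>\<delta>/2\<close> when \<open>C \<delta> \<le> 1/2\<close>, and moves each sequence by at most \<open>\<delta>\<close> and the midpoint by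
  at most \<open>(C/2) \<delta>\<^sup>2\<close>. Summing the resulting geometric series gives convergence and the
  distances \<open>2 \<delta>\<close> and \<open>3 \<delta>\<close> to the limit. Summing the midpoint moves from the second pair on gives
  \<open>(C/2) (4/3) \<delta>\<^sub>1\<^sup>2 \<le> (2/3) C\<^sup>3 \<delta>\<^sub>0\<^sup>4\<close>, the fourth-order estimate
  (\<open>limit_near_second_midpoint\<close>).

  The invariant domain consists of the pairs whose gap is below \<open>\<epsilon>\<close> and whose midpoint keeps a
  distance of more than twice the gap from the boundary of a coordinate ball: in one step the midpoint
  moves by at most \<open>\<delta>/4\<close> while twice the gap falls by at least \<open>\<delta>\<close>. On this domain the iterates converge
  uniformly, so the limit is continuous; symmetry and idempotence pass from the means to the limit.
\<close>

section \<open>Finite-dimensional inner product spaces\<close>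

text \<open>
  The model space is only assumed to be spanned by a finite set. Orthogonalising and normalising
  that set gives the coordinates needed for operator bounds and for the compactness of balls.
\<close>

lemma finite_orthonormal_frame:
  fixes B :: "'e::real_inner set"
  assumes "finite B" "span B = UNIV"
  obtains E :: "'e set"
  where "finite E" "\<And>b. b \<in> E \<Longrightarrow> norm b = 1" "\<And>v. v = (\<Sum>b\<in>E. (v \<bullet> b) *\<^sub>R b)"
proof -
  obtain C :: "'e set" where C: "finite C" "span C = UNIV" "pairwise orthogonal C"
    using basis_orthogonal[OF assms(1)] assms(2) by auto
  define E where "E = sgn ` (C - {0})"
  have fin: "finite E" using C by (simp add: E_def)
  have unit: "norm b = 1" if "b \<in> E" for b using that by (auto simp: E_def norm_sgn split: if_splits)
  have orth: "a \<bullet> b = (if a = b then 1 else 0)" if ab: "a \<in> E" "b \<in> E" for a b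
  proof (cases "a = b")
    case True then show ?thesis using unit[OF ab(1)] by (simp add: norm_eq_1)
  next
    case False
    then obtain c d where "a = sgn c" "b = sgn d" "c \<in> C" "d \<in> C" "c \<noteq> d"
      using ab by (auto simp: E_def)
    then show ?thesis
      using False C(3) by (auto simp: pairwise_def orthogonal_def sgn_div_norm)
  qed
  \<comment> \<open>The vectors that equal their own expansion form a subspace containing the spanning set.\<close>
  have "subspace {v. v = (\<Sum>b\<in>E. (v \<bullet> b) *\<^sub>R b)}"
    by (auto simp: subspace_def inner_add_left scaleR_left_distrib sum.distrib
        simp flip: scaleR_scaleR scaleR_right.sum)
  moreover have "C \<subseteq> {v. v = (\<Sum>b\<in>E. (v \<bullet> b) *\<^sub>R b)}"
  proof clarify
    fix c assume c: "c \<in> C"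
    show "c = (\<Sum>b\<in>E. (c \<bullet> b) *\<^sub>R b)"
    proof (cases "c = 0")
      case False
      then have e: "sgn c \<in> E" using c by (simp add: E_def)
      have cn: "c = norm c *\<^sub>R sgn c" using False by (simp add: sgn_div_norm)
      have "(\<Sum>b\<in>E. (c \<bullet> b) *\<^sub>R b) = (\<Sum>b\<in>E. if sgn c = b then norm c *\<^sub>R b else 0)"
        by (rule sum.cong[OF refl], subst cn) (simp add: orth[OF e])
      also have "\<dots> = c" using e fin cn by simp
      finally show ?thesis by simp
    qed simp
  qed
  ultimately have "span C \<subseteq> {v. v = (\<Sum>b\<in>E. (v \<bullet> b) *\<^sub>R b)}" by (rule span_minimal[rotated])
  then have "v = (\<Sum>b\<in>E. (v \<bullet> b) *\<^sub>R b)" for v using C(2) by blast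
  with fin unit show ?thesis by (rule that)
qed

lemma span_product_frame:
  assumes "span B = (UNIV :: 'a::real_vector set)" "span C = (UNIV :: 'b::real_vector set)"
  shows "span ((\<lambda>x. (x, 0)) ` B \<union> Pair 0 ` C) = UNIV" (is "span ?S = UNIV")
proof -
  have l: "linear (\<lambda>x::'a. (x, 0::'b))" "linear (Pair (0::'a) :: 'b \<Rightarrow> _)"
    by (auto intro!: linearI)
  have "(x, 0) \<in> span ?S" for x
    using linear_span_image[OF l(1), of B] span_mono[of "(\<lambda>x. (x, 0)) ` B" ?S] assms(1) by auto
  moreover have "(0, y) \<in> span ?S" for y
    using linear_span_image[OF l(2), of C] span_mono[of "Pair 0 ` C" ?S] assms(2) by auto
  ultimately have "(x, 0) + (0, y) \<in> span ?S" for x y by (blast intro: span_add)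
  then show ?thesis by (auto simp: set_eq_iff)
qed

text \<open>
  A ball lies in the continuous image of a product of compact intervals, one for each coordinate in
  an orthonormal frame.
\<close>

lemma compact_cball_finite_span:
  fixes B :: "'e::real_inner set"
  assumes "finite B" "span B = UNIV"
  shows "compact (cball (p::'e) r)"
proof -
  obtain E :: "'e set" where E: "finite E" "\<And>b. b \<in> E \<Longrightarrow> norm b = 1"
    "\<And>v. v = (\<Sum>b\<in>E. (v \<bullet> b) *\<^sub>R b)"
    using finite_orthonormal_frame[OF assms] by metis
  define T :: "('e \<Rightarrow> real) \<Rightarrow> 'e" where "T c = p + (\<Sum>b\<in>E. c b *\<^sub>R b)" for c
  define Box :: "('e \<Rightarrow> real) set" where "Box = PiE UNIV (\<lambda>_. {-r..r})"
  have "compactin (product_topology (\<lambda>_::'e. euclideanreal) UNIV) Box"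
    unfolding Box_def by (subst compactin_PiE) auto
  then have "compact Box" by (simp add: euclidean_product_topology)
  moreover have "continuous_on Box T"
    unfolding T_def
    by (intro continuous_intros continuous_on_subset[OF continuous_on_product_coordinates]) auto
  ultimately have "compact (T ` Box)" by (rule compact_continuous_image[rotated])
  moreover have "cball p r \<subseteq> T ` Box"
  proof
    fix x assume x: "x \<in> cball p r"
    define c where "c b = (if b \<in> E then (x - p) \<bullet> b else 0)" for b
    have "0 \<le> r" using x by (meson dual_order.trans mem_cball zero_le_dist)
    moreover have "\<bar>(x - p) \<bullet> b\<bar> \<le> r" if "b \<in> E" for b
      using Cauchy_Schwarz_ineq2[of "x - p" b] E(2)[OF that] x by (simp add: dist_norm norm_minus_commute)
    ultimately have "c \<in> Box" by (auto simp: Box_def c_def abs_le_iff minus_le_iff)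
    moreover have "T c = x" using E(3)[of "x - p"] by (simp add: T_def c_def)
    ultimately show "x \<in> T ` Box" by blast
  qed
  ultimately show ?thesis using closed_cball compact_Int_closed[of "T ` Box" "cball p r"]
    by (simp add: inf.absorb_iff2)
qed

section \<open>Uniform first and second order estimates\<close>

text \<open>
  Regularity is given through directional derivatives; this bound turns control of finitely many
  directions into control of the derivative as a linear map.
\<close>

lemma linear_norm_le_frame:
  fixes E :: "'a::real_inner set"
  assumes "linear g" "\<And>b. b \<in> E \<Longrightarrow> norm b = 1" "\<And>v. v = (\<Sum>b\<in>E. (v \<bullet> b) *\<^sub>R b)"
  shows "norm (g v) \<le> (\<Sum>b\<in>E. norm (g b)) * norm v"
proof -
  have "g v = (\<Sum>b\<in>E. (v \<bullet> b) *\<^sub>R g b)"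
    by (subst assms(3)) (simp add: linear_sum[OF assms(1)] linear_scale[OF assms(1)])
  also have "norm \<dots> \<le> (\<Sum>b\<in>E. norm (g b) * norm v)"
  proof (rule sum_norm_le)
    fix b assume "b \<in> E"
    then show "norm ((v \<bullet> b) *\<^sub>R g b) \<le> norm (g b) * norm v"
      using Cauchy_Schwarz_ineq2[of v b] assms(2)[of b] by (simp add: mult.commute[of "norm (g b)"] mult_right_mono)
  qed
  finally show ?thesis by (simp add: sum_distrib_right)
qed

text \<open>
  Estimates that hold for all pairs of points near \<open>p\<close> are phrased as eventual statements at
  \<open>(p, p)\<close>: they can be combined and pulled back along maps by limit rules, with no radii to track.
  A ball, which is convex, is only needed where a segment is followed.
\<close>

lemma eventually_nhds_diagonal:
  fixes p :: "'a::metric_space"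
  shows "(\<forall>\<^sub>F (x, y) in nhds (p, p). P x y) \<longleftrightarrow> (\<exists>r>0. \<forall>x\<in>ball p r. \<forall>y\<in>ball p r. P x y)"
    (is "?l = ?r")
proof
  assume ?l
  then obtain Q where "eventually Q (nhds p)" "\<And>x y. Q x \<Longrightarrow> Q y \<Longrightarrow> P x y"
    by (auto simp: nhds_prod eventually_prod_same)
  then show ?r by (auto simp: eventually_nhds_metric dist_commute)
next
  assume ?r
  then obtain r where "r > 0" "\<forall>x\<in>ball p r. \<forall>y\<in>ball p r. P x y" by blast
  moreover have "\<forall>\<^sub>F x in nhds p. x \<in> ball p r" using \<open>r > 0\<close> by (intro eventually_nhds_in_open) auto
  ultimately show ?l by (auto simp: nhds_prod eventually_prod_same)
qed

text \<open>
  Near \<open>p\<close> the directional derivatives along a frame stay within \<open>1\<close> of their values at \<open>p\<close>, so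
  the derivative is bounded on a ball and the mean value inequality applies.
\<close>

lemma C1_locally_Lipschitz:
  fixes f :: "'a::real_inner \<Rightarrow> 'b::real_normed_vector"
  assumes "finite (B::'a set)" "span B = UNIV" and S: "open S" "p \<in> S" and f: "Ck_on (Suc 0) S f"
  shows "\<exists>L\<ge>0. \<forall>\<^sub>F (x, y) in nhds (p, p). norm (f x - f y) \<le> L * norm (x - y)"
proof -
  obtain E :: "'a set" where E: "finite E" "\<And>b. b \<in> E \<Longrightarrow> norm b = 1"
    "\<And>v. v = (\<Sum>b\<in>E. (v \<bullet> b) *\<^sub>R b)"
    using finite_orthonormal_frame[OF assms(1,2)] by metis
  let ?D = "\<lambda>x. frechet_derivative f (at x)"
  define L where "L = (\<Sum>b\<in>E. norm (?D p b) + 1)"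
  have ev: "\<forall>\<^sub>F x in nhds p. norm (?D x b) < norm (?D p b) + 1" for b
  proof -
    have "isCont (\<lambda>x. ?D x b) p" using f S by (auto simp: continuous_on_eq_continuous_at)
    then have "((\<lambda>x. norm (?D x b)) \<longlongrightarrow> norm (?D p b)) (nhds p)"
      by (intro tendsto_norm iffD1[OF tendsto_at_iff_tendsto_nhds]) (simp add: continuous_at)
    then show ?thesis by (rule order_tendstoD) simp
  qed
  have "\<forall>\<^sub>F x in nhds p. x \<in> S \<and> (\<forall>b\<in>E. norm (?D x b) < norm (?D p b) + 1)"
    using ev S by (auto intro!: eventually_conj eventually_nhds_in_open eventually_ball_finite E)
  then obtain r where r: "r > 0"
    and near: "\<And>x. x \<in> ball p r \<Longrightarrow> x \<in> S \<and> (\<forall>b\<in>E. norm (?D x b) < norm (?D p b) + 1)"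
    by (auto simp: eventually_nhds_metric dist_commute)
  have "norm (f x - f y) \<le> L * norm (x - y)" if xy: "x \<in> ball p r" "y \<in> ball p r" for x y
  proof -
    let ?g = "\<lambda>t. y + t *\<^sub>R (x - y)"
    have g: "?g t \<in> ball p r" if "t \<in> {0..1}" for t :: real
      using convexD_alt[OF convex_ball xy(2,1), of t] that
      by (simp add: algebra_simps)
    have "norm (f (?g 1) - f (?g 0)) \<le> (L * norm (x - y)) * norm (1 - 0 :: real)"
    proof (rule differentiable_bound[where S = "{0..1::real}"])
      fix t :: real assume t: "t \<in> {0..1}"
      have d: "(f has_derivative ?D (?g t)) (at (?g t))"
        using near[OF g[OF t]] f by (auto simp: frechet_derivative_works)
      then show "((\<lambda>t. f (?g t)) has_derivative (\<lambda>s. ?D (?g t) (s *\<^sub>R (x - y)))) (at t within {0..1})"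
        by (rule has_derivative_compose[rotated]) (auto intro!: derivative_eq_intros)
      have lin: "linear (?D (?g t))" using d by (rule has_derivative_linear)
      have "norm (?D (?g t) v) \<le> L * norm v" for v
      proof -
        have "norm (?D (?g t) v) \<le> (\<Sum>b\<in>E. norm (?D (?g t) b)) * norm v"
          by (rule linear_norm_le_frame[OF lin E(2,3)])
        also have "\<dots> \<le> L * norm v"
          unfolding L_def using near[OF g[OF t]]
          by (intro mult_right_mono sum_mono) (auto intro: less_imp_le)
        finally show ?thesis .
      qed
      from this[of "_ *\<^sub>R (x - y)"] show "onorm (\<lambda>s. ?D (?g t) (s *\<^sub>R (x - y))) \<le> L * norm (x - y)"
        by (intro onorm_le) (simp add: mult_ac)
    qed auto
    then show ?thesis by simp
  qed
  moreover have "L \<ge> 0" unfolding L_def by (intro sum_nonneg) auto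
  ultimately show ?thesis using r unfolding eventually_nhds_diagonal by blast
qed

text \<open>
  The derivative is locally Lipschitz. With \<open>m\<close> the midpoint and \<open>v\<close> half the difference of \<open>x\<close> and
  \<open>y\<close>, the function \<open>t \<mapsto> f (m + t v) + f (m - t v)\<close> therefore has a derivative of size
  \<open>O(norm v ^ 2)\<close>, because its two terms nearly cancel. Comparing \<open>t = 0\<close> with \<open>t = 1\<close> gives the claim.
\<close>

lemma C2_midpoint_defect:
  fixes f :: "'a::real_inner \<Rightarrow> 'b::real_normed_vector"
  assumes "finite (B::'a set)" "span B = UNIV" and S: "open S" "p \<in> S" and f: "Ck_on 2 S f"
  shows "\<exists>L\<ge>0. \<forall>\<^sub>F (x, y) in nhds (p, p).
    norm (midpoint (f x) (f y) - f (midpoint x y)) \<le> L * (norm (x - y))\<^sup>2"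
proof -
  obtain E :: "'a set" where E: "finite E" "\<And>b. b \<in> E \<Longrightarrow> norm b = 1"
    "\<And>v. v = (\<Sum>b\<in>E. (v \<bullet> b) *\<^sub>R b)"
    using finite_orthonormal_frame[OF assms(1,2)] by metis
  let ?D = "\<lambda>x. frechet_derivative f (at x)"
  have "Ck_on (Suc 0) S (\<lambda>x. ?D x b)" for b using f by (auto simp: numeral_2_eq_2)
  then have "\<forall>b. \<exists>L\<ge>0. \<forall>\<^sub>F (x, y) in nhds (p, p). norm (?D x b - ?D y b) \<le> L * norm (x - y)"
    using C1_locally_Lipschitz[OF assms(1-4)] by blast
  then obtain l where l: "\<And>b. l b \<ge> 0"
    "\<And>b. \<forall>\<^sub>F z in nhds (p, p). norm (?D (fst z) b - ?D (snd z) b) \<le> l b * norm (fst z - snd z)"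
    by (metis (no_types, lifting) case_prod_beta' eventually_mono)
  define L where "L = (\<Sum>b\<in>E. l b)"
  have L0: "L \<ge> 0" using l by (simp add: L_def sum_nonneg)
  have "\<forall>\<^sub>F z in nhds (p, p). z \<in> S \<times> S \<and>
      (\<forall>b\<in>E. norm (?D (fst z) b - ?D (snd z) b) \<le> l b * norm (fst z - snd z))"
    using S l(2) by (auto intro!: eventually_conj eventually_nhds_in_open open_Times
        eventually_ball_finite E)
  then have "\<forall>\<^sub>F (x, y) in nhds (p, p). x \<in> S \<and> y \<in> S \<and>
      (\<forall>b\<in>E. norm (?D x b - ?D y b) \<le> l b * norm (x - y))"
    by eventually_elim auto
  then obtain r where r: "r > 0" and near: "\<And>x y. x \<in> ball p r \<Longrightarrow> y \<in> ball p r \<Longrightarrow>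
      x \<in> S \<and> y \<in> S \<and> (\<forall>b\<in>E. norm (?D x b - ?D y b) \<le> l b * norm (x - y))"
    unfolding eventually_nhds_diagonal by blast
  have deriv: "(f has_derivative ?D x) (at x)" if "x \<in> ball p r" for x
    using near[OF that that] f by (auto simp: frechet_derivative_works numeral_2_eq_2)
  have lip: "norm (?D x v - ?D y v) \<le> L * norm (x - y) * norm v"
    if xy: "x \<in> ball p r" "y \<in> ball p r" for x y v
  proof -
    have "linear (\<lambda>v. ?D x v - ?D y v)"
      using deriv xy by (intro linear_compose_sub has_derivative_linear)
    then have "norm (?D x v - ?D y v) \<le> (\<Sum>b\<in>E. norm (?D x b - ?D y b)) * norm v"
      by (rule linear_norm_le_frame[OF _ E(2,3)])
    also have "\<dots> \<le> (\<Sum>b\<in>E. l b * norm (x - y)) * norm v"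
      using near[OF xy] by (intro mult_right_mono sum_mono) auto
    finally show ?thesis by (simp add: L_def sum_distrib_right)
  qed
  have "norm (midpoint (f x) (f y) - f (midpoint x y)) \<le> L / 4 * (norm (x - y))\<^sup>2"
    if xy: "x \<in> ball p r" "y \<in> ball p r" for x y
  proof -
    define m v where "m = midpoint x y" and "v = (x - y) /\<^sub>R 2"
    have x: "x = m + v" and y: "y = m - v"
      by (simp_all add: m_def v_def midpoint_def algebra_simps flip: scaleR_left_distrib)
    have m: "m \<in> ball p r"
      using convexD_alt[OF convex_ball xy, of "1/2"] by (simp add: m_def midpoint_def algebra_simps)
    have g: "m + t *\<^sub>R v \<in> ball p r" "m - t *\<^sub>R v \<in> ball p r" if "t \<in> {0..1}" for t :: real
      using convexD_alt[OF convex_ball m xy(1), of t] convexD_alt[OF convex_ball m xy(2), of t] that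
      by (simp_all add: x y algebra_simps)
    let ?g = "\<lambda>t. f (m + t *\<^sub>R v) + f (m - t *\<^sub>R v)"
    have "norm (?g 1 - ?g 0) \<le> (2 * L * (norm v)\<^sup>2) * norm (1 - 0 :: real)"
    proof (rule differentiable_bound[where S = "{0..1::real}"])
      fix t :: real assume t: "t \<in> {0..1}"
      note d = deriv[OF g(1)[OF t]] deriv[OF g(2)[OF t]]
      have "((\<lambda>t. f (m + t *\<^sub>R v)) has_derivative (\<lambda>s. ?D (m + t *\<^sub>R v) (s *\<^sub>R v))) (at t within {0..1})"
        by (rule has_derivative_compose[where f = "\<lambda>t. m + t *\<^sub>R v" and g = f, OF _ d(1)]) (auto intro!: derivative_eq_intros)
      moreover have "((\<lambda>t. f (m - t *\<^sub>R v)) has_derivative (\<lambda>s. ?D (m - t *\<^sub>R v) (- (s *\<^sub>R v))))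
          (at t within {0..1})"
        by (rule has_derivative_compose[where f = "\<lambda>t. m - t *\<^sub>R v" and g = f, OF _ d(2)]) (auto intro!: derivative_eq_intros)
      ultimately show "(?g has_derivative
          (\<lambda>s. ?D (m + t *\<^sub>R v) (s *\<^sub>R v) + ?D (m - t *\<^sub>R v) (- (s *\<^sub>R v)))) (at t within {0..1})"
        by (rule has_derivative_add)
      show "onorm (\<lambda>s. ?D (m + t *\<^sub>R v) (s *\<^sub>R v) + ?D (m - t *\<^sub>R v) (- (s *\<^sub>R v)))
          \<le> 2 * L * (norm v)\<^sup>2"
      proof (rule onorm_le)
        fix s :: real
        have "norm (?D (m + t *\<^sub>R v) (s *\<^sub>R v) + ?D (m - t *\<^sub>R v) (- (s *\<^sub>R v)))
            = norm (?D (m + t *\<^sub>R v) (s *\<^sub>R v) - ?D (m - t *\<^sub>R v) (s *\<^sub>R v))"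
          by (simp add: linear_neg[OF has_derivative_linear[OF d(2)]])
        also have "\<dots> \<le> L * norm ((m + t *\<^sub>R v) - (m - t *\<^sub>R v)) * norm (s *\<^sub>R v)"
          using g[OF t] by (rule lip)
        also have "(m + t *\<^sub>R v) - (m - t *\<^sub>R v) = (2 * t) *\<^sub>R v"
          by (simp add: algebra_simps flip: scaleR_left_distrib)
        also have "L * norm ((2 * t) *\<^sub>R v) * norm (s *\<^sub>R v) = t * (2 * L * (norm v)\<^sup>2 * norm s)"
          using t by (simp add: power2_eq_square)
        also have "\<dots> \<le> 1 * (2 * L * (norm v)\<^sup>2 * norm s)"
          using t L0 by (intro mult_right_mono) auto
        finally show "norm (?D (m + t *\<^sub>R v) (s *\<^sub>R v) + ?D (m - t *\<^sub>R v) (- (s *\<^sub>R v)))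
            \<le> 2 * L * (norm v)\<^sup>2 * norm s" by simp
      qed
    qed auto
    moreover have "?g 1 - ?g 0 = 2 *\<^sub>R (midpoint (f x) (f y) - f m)"
      by (simp add: x y midpoint_def algebra_simps scaleR_2)
    moreover have "norm v = norm (x - y) / 2" by (simp add: v_def)
    ultimately show ?thesis by (simp add: m_def power2_eq_square)
  qed
  moreover have "L / 4 \<ge> 0" using L0 by simp
  ultimately show ?thesis using r unfolding eventually_nhds_diagonal by blast
qed

section \<open>Means in coordinates\<close>

lemma is_chartD:
  assumes "is_chart (V, \<phi>)"
  shows "open V" "open (\<phi> ` V)" "inj_on \<phi> V" "continuous_on V \<phi>"
    "continuous_on (\<phi> ` V) (inv_into V \<phi>)"
  using assms by (auto simp: is_chart_def homeomorphism_def intro: inj_on_inverseI)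

lemma chart_image_open:
  assumes "is_chart (V, \<phi>)" "open N" "N \<subseteq> V"
  shows "open (\<phi> ` N)"
proof -
  have "openin (top_of_set (\<phi> ` V)) (\<phi> ` N)"
    using assms by (auto simp: is_chart_def intro: homeomorphism_imp_open_map openin_open_eq[THEN iffD2])
  then show ?thesis using is_chartD(2)[OF assms(1)] by (simp add: openin_open_eq)
qed

lemma chart_tendsto:
  fixes x :: "'p::t2_space"
  assumes "is_chart (V, \<phi>)" "x \<in> V"
  shows "(\<phi> \<longlongrightarrow> \<phi> x) (nhds x)"
proof -
  have "isCont \<phi> x"
    using is_chartD(1,4)[OF assms(1)] assms(2) continuous_on_eq_continuous_at by blast
  then show ?thesis by (simp add: isCont_def tendsto_at_iff_tendsto_nhds)
qed

text \<open>
  The coordinate form of a mean lives in a product chart. Its inverse \<open>inv_into\<close> is identified here with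
  the inverse of the factor chart, applied to both components.
\<close>

lemma is_chart_square:
  assumes "is_chart (V, \<phi>)"
  shows "is_chart (V \<times> V, map_prod \<phi> \<phi>)"
proof -
  have inj: "inj_on (map_prod \<phi> \<phi>) (V \<times> V)"
    using is_chartD(3)[OF assms] by (intro map_prod_inj_on)
  have im: "map_prod \<phi> \<phi> ` (V \<times> V) = \<phi> ` V \<times> \<phi> ` V" by auto
  have "continuous_on (V \<times> V) (map_prod \<phi> \<phi>)"
    unfolding map_prod_def case_prod_beta
    by (intro continuous_intros continuous_on_compose2[OF is_chartD(4)[OF assms]]) auto
  moreover have inv: "inv_into (V \<times> V) (map_prod \<phi> \<phi>) (\<phi> x, \<phi> y) = (x, y)"
    if "x \<in> V" "y \<in> V" for x y
    using that inv_into_f_f[OF inj, of "(x, y)"] by simp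
  moreover have "continuous_on (\<phi> ` V \<times> \<phi> ` V) (inv_into (V \<times> V) (map_prod \<phi> \<phi>))"
  proof (subst continuous_on_cong[OF refl])
    show "inv_into (V \<times> V) (map_prod \<phi> \<phi>) z = (inv_into V \<phi> (fst z), inv_into V \<phi> (snd z))"
      if "z \<in> \<phi> ` V \<times> \<phi> ` V" for z
      using that is_chartD(3)[OF assms] by (auto simp: inv)
    show "continuous_on (\<phi> ` V \<times> \<phi> ` V) (\<lambda>z. (inv_into V \<phi> (fst z), inv_into V \<phi> (snd z)))"
      by (intro continuous_intros continuous_on_compose2[OF is_chartD(5)[OF assms]]) auto
  qed
  moreover have "inv_into (V \<times> V) (map_prod \<phi> \<phi>) ` (\<phi> ` V \<times> \<phi> ` V) = V \<times> V"
    by (force simp: inv)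
  ultimately have "homeomorphism (V \<times> V) (\<phi> ` V \<times> \<phi> ` V) (map_prod \<phi> \<phi>) (inv_into (V \<times> V) (map_prod \<phi> \<phi>))"
    by (auto simp: homeomorphism_def im)
  then show ?thesis using is_chartD[OF assms] by (simp add: is_chart_def im open_Times)
qed

lemma tendsto_midpoint:
  fixes a b :: "'a::real_normed_vector"
  assumes "(f \<longlongrightarrow> a) F" "(g \<longlongrightarrow> b) F"
  shows "((\<lambda>x. midpoint (f x) (g x)) \<longlongrightarrow> midpoint a b) F"
  unfolding midpoint_def by (intro tendsto_intros assms)

text \<open>
  The regularity hypothesis speaks about charts \<open>(V', \<psi>)\<close> of the atlas only, so the estimate is first
  obtained there. The midpoint defect of \<open>F\<close> is evaluated between \<open>(a, b)\<close> and \<open>(b, a)\<close>: by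
  symmetry both values agree, and by idempotence the value at their midpoint \<open>(m, m)\<close> is \<open>m\<close>.
  With \<open>\<tau>\<close> the transition to the chart \<open>\<phi>\<close>, the point \<open>\<tau> m\<close> differs from the \<open>\<phi>\<close>-midpoint by the
  midpoint defect of \<open>\<tau>\<close>, and the inverse transition \<open>\<sigma>\<close> converts distances back.
\<close>

lemma mean_near_midpoint:
  fixes \<A> :: "('p::{t2_space, second_countable_topology}, 'e::real_inner) chart set"
  assumes manifold: "smooth_manifold \<A>"
    and W: "open W" "(base, base) \<in> W"
    and N: "Ck_map 2 (product_atlas \<A> \<A>) \<A> W N" "symmetric_on W N" "idempotent_on W N"
    and chart: "(V, \<phi>) \<in> coordinate_charts \<A>" "base \<in> V"
  shows "\<exists>C>0. \<forall>\<^sub>F (X, Y) in nhds (base, base). X \<in> V \<and> Y \<in> V \<and> (X, Y) \<in> W \<and> N (X, Y) \<in> V \<and>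
    norm (\<phi> (N (X, Y)) - midpoint (\<phi> X) (\<phi> Y)) \<le> C * (norm (\<phi> X - \<phi> Y))\<^sup>2"
proof -
  obtain B :: "'e set" where B: "finite B" "span B = UNIV"
    using manifold by (auto simp: smooth_manifold_def)
  let ?B2 = "(\<lambda>x. (x, 0)) ` B \<union> Pair 0 ` B"
  have B2: "finite ?B2" "span ?B2 = UNIV" using B(1) by (simp, intro span_product_frame B(2))
  have "base \<in> (\<Union>c\<in>\<A>. fst c)" using manifold by (simp add: smooth_manifold_def)
  then obtain V' \<psi> where atlas: "(V', \<psi>) \<in> \<A>" "base \<in> V'" by auto
  have \<psi>: "is_chart (V', \<psi>)" and \<phi>: "is_chart (V, \<phi>)"
    using atlas(1) manifold chart(1) unfolding smooth_manifold_def coordinate_charts_def by blast+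
  define \<tau> where "\<tau> = \<phi> \<circ> inv_into V' \<psi>"
  define \<sigma> where "\<sigma> = \<psi> \<circ> inv_into V \<phi>"
  define F where "F = \<psi> \<circ> N \<circ> inv_into (V' \<times> V') (map_prod \<psi> \<psi>)"
  have "smoothly_compatible (V, \<phi>) (V', \<psi>)" using chart(1) atlas(1) by (simp add: coordinate_charts_def)
  then have \<tau>: "Ck_on k (\<psi> ` (V \<inter> V')) \<tau>" and \<sigma>: "Ck_on k (\<phi> ` (V \<inter> V')) \<sigma>" for k
    by (simp_all add: \<tau>_def \<sigma>_def smoothly_compatible_def smooth_on_def)
  have chart_sq: "(V' \<times> V', map_prod \<psi> \<psi>) \<in> product_atlas \<A> \<A>"
    using atlas by (auto simp: product_atlas_def)
  have Ncont: "continuous_on W N" using N(1) by (auto simp: Ck_map_def)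
  have F: "Ck_on 2 (map_prod \<psi> \<psi> ` (W \<inter> V' \<times> V' \<inter> N -` V')) F"
    using N(1) chart_sq atlas(1) unfolding Ck_map_def F_def by blast
  have V: "open V" "open V'" by (rule is_chartD(1)[OF \<phi>], rule is_chartD(1)[OF \<psi>])
  have Nb: "N (base, base) = base" using W(2) N(3) by (simp add: idempotent_on_def)
  have Nlim: "(N \<longlongrightarrow> base) (nhds (base, base))"
  proof -
    have "isCont N (base, base)" using Ncont W continuous_on_eq_continuous_at by blast
    then show ?thesis using iffD1[OF tendsto_at_iff_tendsto_nhds, of N "(base, base)"]
      by (simp add: isCont_def Nb)
  qed
  have "open (N -` V' \<inter> W)" using Ncont V W(1) by (simp add: continuous_on_open_vimage)
  then have "open (W \<inter> V' \<times> V' \<inter> N -` V')"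
    using open_Int[OF _ open_Times[OF V(2) V(2)], of "N -` V' \<inter> W"] by (simp add: Int_ac)
  then have SF: "open (map_prod \<psi> \<psi> ` (W \<inter> V' \<times> V' \<inter> N -` V'))"
    by (rule chart_image_open[OF is_chart_square[OF \<psi>]]) auto
  have S\<tau>: "open (\<psi> ` (V \<inter> V'))" and S\<sigma>: "open (\<phi> ` (V \<inter> V'))"
    using V by (auto intro: chart_image_open[OF \<psi>] chart_image_open[OF \<phi>])
  define q where "q = \<psi> base"
  have qF: "(q, q) \<in> map_prod \<psi> \<psi> ` (W \<inter> V' \<times> V' \<inter> N -` V')"
    using W(2) atlas(2) Nb unfolding q_def by (intro image_eqI[of _ _ "(base, base)"]) auto
  have q: "q \<in> \<psi> ` (V \<inter> V')" "\<phi> base \<in> \<phi> ` (V \<inter> V')" using chart(2) atlas(2) by (auto simp: q_def)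

  obtain L1 where L1: "L1 \<ge> 0" "\<forall>\<^sub>F z in nhds (q, q).
      norm (midpoint (\<tau> (fst z)) (\<tau> (snd z)) - \<tau> (midpoint (fst z) (snd z))) \<le> L1 * (norm (fst z - snd z))\<^sup>2"
    using C2_midpoint_defect[OF B S\<tau> q(1) \<tau>] by (auto simp: case_prod_unfold)
  obtain L2 where L2: "L2 \<ge> 0" "\<forall>\<^sub>F z in nhds (q, q). norm (\<tau> (fst z) - \<tau> (snd z)) \<le> L2 * norm (fst z - snd z)"
    using C1_locally_Lipschitz[OF B S\<tau> q(1) \<tau>] by (auto simp: case_prod_unfold)
  obtain L3 where L3: "L3 \<ge> 0" "\<forall>\<^sub>F z in nhds (\<phi> base, \<phi> base).
      norm (\<sigma> (fst z) - \<sigma> (snd z)) \<le> L3 * norm (fst z - snd z)"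
    using C1_locally_Lipschitz[OF B S\<sigma> q(2) \<sigma>] by (auto simp: case_prod_unfold)
  obtain L4 where L4: "L4 \<ge> 0" "\<forall>\<^sub>F z in nhds ((q, q), (q, q)).
      norm (midpoint (F (fst z)) (F (snd z)) - F (midpoint (fst z) (snd z))) \<le> L4 * (norm (fst z - snd z))\<^sup>2"
    using C2_midpoint_defect[OF B2 SF qF F] by (auto simp: case_prod_unfold)

  let ?N = "nhds (base, base)"
  have lim1: "(fst \<longlongrightarrow> base) ?N" and lim2: "(snd \<longlongrightarrow> base) ?N"
    using tendsto_fst[OF filterlim_ident, of "(base, base)"] tendsto_snd[OF filterlim_ident, of "(base, base)"]
    by simp_all
  note \<psi>lim = filterlim_compose[OF chart_tendsto[OF \<psi> atlas(2)], folded q_def]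
  note \<phi>lim = filterlim_compose[OF chart_tendsto[OF \<phi> chart(2)]]
  have mid: "((\<lambda>z. midpoint (\<psi> (fst z)) (\<psi> (snd z))) \<longlongrightarrow> q) ?N"
    using tendsto_midpoint[OF \<psi>lim[OF lim1] \<psi>lim[OF lim2]] by simp
  have swap: "((\<lambda>z. (snd z, fst z)) \<longlongrightarrow> (base, base)) ?N" by (rule tendsto_Pair[OF lim2 lim1])
  have in_open: "\<forall>\<^sub>F z in ?N. f z \<in> T" if "(f \<longlongrightarrow> a) ?N" "open T" "a \<in> T"
    for f :: "_ \<Rightarrow> 'x::topological_space" and a T using that by (rule topological_tendstoD)
  \<comment> \<open>Idempotence can be used at the midpoint \<open>m\<close> only if \<open>m\<close> is the image of some \<open>x\<close> with \<open>(x, x) \<in> W\<close>.\<close>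
  have "open ((\<lambda>x. (x, x)) -` W)"
    by (rule open_vimage[OF W(1)]) (intro continuous_intros)
  then have diag: "open (\<psi> ` (V' \<inter> (\<lambda>x. (x, x)) -` W))"
    using V by (intro chart_image_open[OF \<psi>]) auto
  have VV': "open (V \<inter> V')" "base \<in> V \<inter> V'" using V chart(2) atlas(2) by auto
  have "\<forall>\<^sub>F z in ?N. fst z \<in> V \<inter> V'" "\<forall>\<^sub>F z in ?N. snd z \<in> V \<inter> V'" "\<forall>\<^sub>F z in ?N. N z \<in> V \<inter> V'"
    by (rule in_open[OF lim1 VV'] in_open[OF lim2 VV'] in_open[OF Nlim VV'])+
  moreover have "\<forall>\<^sub>F z in ?N. z \<in> W" "\<forall>\<^sub>F z in ?N. (snd z, fst z) \<in> W"
    by (rule in_open[OF swap W] eventually_nhds_in_open[OF W])+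
  moreover have "\<forall>\<^sub>F z in ?N. midpoint (\<psi> (fst z)) (\<psi> (snd z)) \<in> \<psi> ` (V' \<inter> (\<lambda>x. (x, x)) -` W)"
    using W(2) atlas(2) by (intro in_open[OF mid diag]) (auto simp: q_def)
  moreover note
    eventually_compose_filterlim[OF L1(2) tendsto_Pair[OF \<psi>lim[OF lim1] \<psi>lim[OF lim2]]]
    eventually_compose_filterlim[OF L2(2) tendsto_Pair[OF \<psi>lim[OF Nlim] mid]]
    eventually_compose_filterlim[OF L3(2) tendsto_Pair[OF \<phi>lim[OF lim1] \<phi>lim[OF lim2]]]
    eventually_compose_filterlim[OF L4(2) tendsto_Pair[OF
        tendsto_Pair[OF \<psi>lim[OF lim1] \<psi>lim[OF lim2]] tendsto_Pair[OF \<psi>lim[OF lim2] \<psi>lim[OF lim1]]]]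
  \<comment> \<open>The summand \<open>1\<close> makes the constant positive even if all Lipschitz constants vanish.\<close>
  ultimately have "\<forall>\<^sub>F z in ?N. fst z \<in> V \<and> snd z \<in> V \<and> z \<in> W \<and> N z \<in> V \<and>
    norm (\<phi> (N z) - midpoint (\<phi> (fst z)) (\<phi> (snd z)))
      \<le> ((2 * L2 * L4 + L1) * L3\<^sup>2 + 1) * (norm (\<phi> (fst z) - \<phi> (snd z)))\<^sup>2"
  proof eventually_elim
    case (elim z)
    obtain X Y where z: "z = (X, Y)" by (cases z)
    note e = elim[unfolded z fst_conv snd_conv]
    define m where "m = midpoint (\<psi> X) (\<psi> Y)"
    have inj: "inj_on \<psi> V'" "inj_on \<phi> V" "inj_on (map_prod \<psi> \<psi>) (V' \<times> V')"
      by (intro map_prod_inj_on is_chartD(3)[OF \<psi>] is_chartD(3)[OF \<phi>])+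
    have Fval: "F (\<psi> X', \<psi> Y') = \<psi> (N (X', Y'))" if "X' \<in> V'" "Y' \<in> V'" for X' Y'
      using inv_into_f_f[OF inj(3), of "(X', Y')"] that by (simp add: F_def)
    have \<tau>val: "\<tau> (\<psi> X') = \<phi> X'" if "X' \<in> V'" for X'
      using that inj(1) by (simp add: \<tau>_def inv_into_f_f)
    have \<sigma>val: "\<sigma> (\<phi> X') = \<psi> X'" if "X' \<in> V" for X'
      using that inj(2) by (simp add: \<sigma>_def inv_into_f_f)
    have "F (\<psi> X, \<psi> Y) = \<psi> (N (X, Y))" using e by (simp add: Fval)
    moreover have "F (\<psi> Y, \<psi> X) = \<psi> (N (X, Y))"
      using e N(2) by (simp add: Fval symmetric_on_def)
    moreover have "midpoint (\<psi> X, \<psi> Y) (\<psi> Y, \<psi> X) = (m, m)"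
      by (simp add: m_def midpoint_def add.commute)
    moreover obtain x where x: "x \<in> V'" "(x, x) \<in> W" "m = \<psi> x" using e(6) by (auto simp: m_def)
    then have "F (m, m) = m" using N(3) by (simp add: Fval idempotent_on_def)
    moreover have "(norm ((\<psi> X, \<psi> Y) - (\<psi> Y, \<psi> X)))\<^sup>2 = 2 * (norm (\<psi> X - \<psi> Y))\<^sup>2"
      by (simp add: norm_Pair norm_minus_commute)
    ultimately have a: "norm (\<psi> (N (X, Y)) - m) \<le> L4 * (2 * (norm (\<psi> X - \<psi> Y))\<^sup>2)"
      using e(10) by simp
    have "norm (\<phi> (N (X, Y)) - midpoint (\<phi> X) (\<phi> Y))
        \<le> norm (\<phi> (N (X, Y)) - \<tau> m) + norm (midpoint (\<phi> X) (\<phi> Y) - \<tau> m)"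
      using norm_triangle_ineq4[of "\<phi> (N (X, Y)) - \<tau> m" "midpoint (\<phi> X) (\<phi> Y) - \<tau> m"] by simp
    also have "norm (\<phi> (N (X, Y)) - \<tau> m) \<le> L2 * norm (\<psi> (N (X, Y)) - m)"
      using e(3,8) by (simp add: \<tau>val m_def)
    also have "\<dots> \<le> L2 * (L4 * (2 * (norm (\<psi> X - \<psi> Y))\<^sup>2))" using a L2(1) by (rule mult_left_mono)
    also have "norm (midpoint (\<phi> X) (\<phi> Y) - \<tau> m) \<le> L1 * (norm (\<psi> X - \<psi> Y))\<^sup>2"
      using e(1,2,7) by (simp add: \<tau>val m_def)
    also have "L2 * (L4 * (2 * (norm (\<psi> X - \<psi> Y))\<^sup>2)) + L1 * (norm (\<psi> X - \<psi> Y))\<^sup>2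
        = (2 * L2 * L4 + L1) * (norm (\<psi> X - \<psi> Y))\<^sup>2" by (simp add: algebra_simps)
    also have "\<dots> \<le> (2 * L2 * L4 + L1) * (L3 * norm (\<phi> X - \<phi> Y))\<^sup>2"
      using e(1,2,9) L1(1) L2(1) L4(1) by (intro mult_left_mono power_mono) (auto simp: \<sigma>val)
    also have "\<dots> \<le> ((2 * L2 * L4 + L1) * L3\<^sup>2 + 1) * (norm (\<phi> X - \<phi> Y))\<^sup>2"
      by (simp add: algebra_simps power_mult_distrib)
    finally show ?case using e by (simp add: z)
  qed
  moreover have "(2 * L2 * L4 + L1) * L3\<^sup>2 + 1 > 0"
    using L1(1) L2(1) L4(1) by (simp add: add_nonneg_pos)
  ultimately show ?thesis by (intro exI[of _ "(2 * L2 * L4 + L1) * L3\<^sup>2 + 1"]) (simp add: case_prod_unfold)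
qed

section \<open>Sequences of points with quadratically shrinking gaps\<close>

text \<open>
  One step of the iteration in an arbitrary normed space. The factor \<open>C / 2\<close> in the hypotheses is
  what makes the new gap at most \<open>C\<close> times the square of the old one.
\<close>

lemma near_midpoint_step:
  fixes p q p' q' :: "'e::real_normed_vector"
  assumes "C > 0" and small: "C * norm (p - q) \<le> 1 / 2"
    and p': "norm (p' - midpoint p q) \<le> C / 2 * (norm (p - q))\<^sup>2"
    and q': "norm (q' - midpoint p q) \<le> C / 2 * (norm (p - q))\<^sup>2"
  shows "norm (p' - q') \<le> C * (norm (p - q))\<^sup>2"
    and "C * (norm (p - q))\<^sup>2 \<le> norm (p - q) / 2"
    and "norm (p' - p) \<le> norm (p - q)"
    and "norm (midpoint p' q' - midpoint p q) \<le> C / 2 * (norm (p - q))\<^sup>2"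
proof -
  show "norm (p' - q') \<le> C * (norm (p - q))\<^sup>2"
    using norm_triangle_ineq4[of "p' - midpoint p q" "q' - midpoint p q"] p' q' by simp
  show half: "C * (norm (p - q))\<^sup>2 \<le> norm (p - q) / 2"
    using mult_right_mono[OF small, of "norm (p - q)"] by (simp add: power2_eq_square mult_ac)
  have "norm (midpoint p q - p) = norm (p - q) / 2"
    using dist_midpoint(1)[of p q] by (simp add: dist_norm norm_minus_commute)
  moreover have "norm (p' - p) \<le> norm (p' - midpoint p q) + norm (midpoint p q - p)"
    using norm_triangle_ineq[of "p' - midpoint p q" "midpoint p q - p"] by simp
  ultimately show "norm (p' - p) \<le> norm (p - q)" using p' half norm_ge_zero[of "p - q"] by linarith
  have "midpoint p' q' - midpoint p q = midpoint (p' - midpoint p q) (q' - midpoint p q)"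
    by (simp add: midpoint_def algebra_simps flip: scaleR_left_distrib)
  then have "norm (midpoint p' q' - midpoint p q) = norm ((p' - midpoint p q) + (q' - midpoint p q)) / 2"
    by (simp add: midpoint_def)
  then show "norm (midpoint p' q' - midpoint p q) \<le> C / 2 * (norm (p - q))\<^sup>2"
    using norm_triangle_ineq[of "p' - midpoint p q" "q' - midpoint p q"] p' q' by linarith
qed

locale near_midpoint_sequences =
  fixes p q :: "nat \<Rightarrow> 'e::real_normed_vector" and C :: real
  assumes C_pos: "C > 0"
    and start: "C * norm (p 0 - q 0) \<le> 1 / 2"
    and p_step: "norm (p (Suc n) - midpoint (p n) (q n)) \<le> C / 2 * (norm (p n - q n))\<^sup>2"
    and q_step: "norm (q (Suc n) - midpoint (p n) (q n)) \<le> C / 2 * (norm (p n - q n))\<^sup>2"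
begin

abbreviation gap :: "nat \<Rightarrow> real" where "gap n \<equiv> norm (p n - q n)"

abbreviation mid :: "nat \<Rightarrow> 'e" where "mid n \<equiv> midpoint (p n) (q n)"

lemma gap_small: "C * gap n \<le> 1 / 2"
proof (induction n)
  case (Suc n)
  have "gap (Suc n) \<le> gap n / 2"
    using near_midpoint_step(1,2)[OF C_pos Suc p_step q_step] by linarith
  then have "gap (Suc n) \<le> gap n" using norm_ge_zero[of "p n - q n"] by linarith
  then have "C * gap (Suc n) \<le> C * gap n" using C_pos by (simp add: mult_left_mono)
  with Suc show ?case by linarith
qed (rule start)

lemmas step = near_midpoint_step[OF C_pos gap_small p_step q_step]

lemma gap_halves: "gap (Suc n) \<le> gap n / 2"
  using step(1,2)[of n] by linarith

lemma gap_geometric: "gap n \<le> gap 0 / 2 ^ n"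
proof (induction n)
  case (Suc n)
  have "gap (Suc n) \<le> gap n / 2" by (rule gap_halves)
  also have "\<dots> \<le> (gap 0 / 2 ^ n) / 2" using Suc by (rule divide_right_mono) simp
  finally show ?case by simp
qed simp

lemma gap_tendsto_0: "gap \<longlonglongrightarrow> 0"
proof (rule tendsto_sandwich[where f = "\<lambda>_. 0" and h = "\<lambda>n. gap 0 / 2 ^ n"])
  show "(\<lambda>n. gap 0 / 2 ^ n) \<longlonglongrightarrow> 0"
    using tendsto_mult_right[OF LIMSEQ_power_zero[of "1/2::real"], of "gap 0"]
    by (simp add: power_divide)
qed (use gap_geometric in auto)

text \<open>
  Each step is at most \<open>gap n \<le> 2 gap n - 2 gap (n + 1)\<close>, as gaps are at least halved; stated with
  the difference, the sum of the steps telescopes.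
\<close>

lemma p_distance: "norm (p (n + k) - p n) \<le> 2 * gap n - 2 * gap (n + k)"
proof (induction k)
  case (Suc k)
  have "norm (p (n + Suc k) - p n) \<le> norm (p (Suc (n + k)) - p (n + k)) + norm (p (n + k) - p n)"
    using norm_triangle_ineq[of "p (Suc (n + k)) - p (n + k)" "p (n + k) - p n"] by simp
  then show ?case using Suc step(3)[of "n + k"] gap_halves[of "n + k"] by simp
qed simp

text \<open>
  The same device one order higher: squared gaps shrink by a factor \<open>4\<close>, so a midpoint step
  \<open>(C/2) (gap n)\<^sup>2\<close> is at most \<open>(2C/3) ((gap n)\<^sup>2 - (gap (n + 1))\<^sup>2)\<close>.
\<close>

lemma mid_distance: "norm (mid (n + k) - mid n) \<le> 2 * C / 3 * ((gap n)\<^sup>2 - (gap (n + k))\<^sup>2)"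
proof (induction k)
  case (Suc k)
  have "norm (mid (n + Suc k) - mid n) \<le> norm (mid (Suc (n + k)) - mid (n + k)) + norm (mid (n + k) - mid n)"
    using norm_triangle_ineq[of "mid (Suc (n + k)) - mid (n + k)" "mid (n + k) - mid n"] by simp
  moreover have "(gap (Suc (n + k)))\<^sup>2 \<le> (gap (n + k))\<^sup>2 / 4"
    using power_mono[OF gap_halves[of "n + k"], of 2] by (simp add: power_divide)
  then have "2 * C / 3 * (gap (Suc (n + k)))\<^sup>2 \<le> 2 * C / 3 * ((gap (n + k))\<^sup>2 / 4)"
    using C_pos by (intro mult_left_mono) auto
  ultimately show ?case using Suc step(4)[of "n + k"] by (simp add: algebra_simps)
qed simp

lemma Cauchy_p: "Cauchy p"
proof (rule CauchyI')
  fix e :: real assume "e > 0"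
  then have "\<forall>\<^sub>F n in sequentially. gap n < e / 2"
    by (intro order_tendstoD(2)[OF gap_tendsto_0]) simp
  then obtain N where N: "\<And>n. n \<ge> N \<Longrightarrow> gap n < e / 2" by (auto simp: eventually_sequentially)
  show "\<exists>N. \<forall>m\<ge>N. \<forall>n>m. dist (p m) (p n) < e"
  proof (intro exI[of _ N] allI impI)
    fix m n assume "m \<ge> N" "n > m"
    then have "norm (p n - p m) \<le> 2 * gap m - 2 * gap n" "gap m < e / 2"
      using p_distance[of m "n - m"] N[of m] by auto
    then have "norm (p n - p m) < e" using norm_ge_zero[of "p n - q n"] by linarith
    then show "dist (p m) (p n) < e" by (simp add: dist_norm norm_minus_commute)
  qed
qed

context
  fixes l
  assumes p_lim: "p \<longlonglongrightarrow> l"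
begin

lemma q_tendsto: "q \<longlonglongrightarrow> l"
proof -
  have "(\<lambda>n. p n - q n) \<longlonglongrightarrow> 0" using gap_tendsto_0 by (simp add: tendsto_norm_zero_iff)
  from tendsto_diff[OF p_lim this] show ?thesis by simp
qed

lemma p_limit_distance: "norm (p n - l) \<le> 2 * gap n"
proof (rule tendsto_upperbound)
  show "(\<lambda>k. norm (p n - p (k + n))) \<longlonglongrightarrow> norm (p n - l)"
    by (intro tendsto_intros LIMSEQ_ignore_initial_segment p_lim)
  have "norm (p (n + k) - p n) \<le> 2 * gap n" for k
    using p_distance[of n k] norm_ge_zero[of "p (n + k) - q (n + k)"] by linarith
  then have "norm (p n - p (k + n)) \<le> 2 * gap n" for k
    by (metis add.commute norm_minus_commute)
  then show "\<forall>\<^sub>F k in sequentially. norm (p n - p (k + n)) \<le> 2 * gap n" by simp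
qed simp

lemma q_limit_distance: "norm (q n - l) \<le> 3 * gap n"
  using norm_triangle_ineq[of "q n - p n" "p n - l"] p_limit_distance[of n]
  by (simp add: norm_minus_commute)

text \<open>
  Summing from index \<open>1\<close> bounds the distance by a multiple of \<open>(gap 1)\<^sup>2\<close>, and \<open>gap 1\<close> is already
  quadratic in \<open>gap 0\<close>; hence the fourth power.
\<close>

lemma limit_near_second_midpoint: "norm (l - mid 1) \<le> 2 / 3 * C ^ 3 * gap 0 ^ 4"
proof (rule tendsto_upperbound)
  show "(\<lambda>k. norm (mid (k + 1) - mid 1)) \<longlonglongrightarrow> norm (l - mid 1)"
    using tendsto_midpoint[OF p_lim q_tendsto]
    by (intro tendsto_intros LIMSEQ_ignore_initial_segment) simp
  have "norm (mid (k + 1) - mid 1) \<le> 2 / 3 * C ^ 3 * gap 0 ^ 4" for k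
  proof -
    have "(gap 1)\<^sup>2 \<le> (C * (gap 0)\<^sup>2)\<^sup>2" using step(1)[of 0] by (simp add: power_mono)
    then have "(gap 1)\<^sup>2 - (gap (1 + k))\<^sup>2 \<le> C\<^sup>2 * gap 0 ^ 4"
      by (simp add: power_mult_distrib flip: power_mult) (smt (verit) zero_le_power2)
    then have "2 * C / 3 * ((gap 1)\<^sup>2 - (gap (1 + k))\<^sup>2) \<le> 2 * C / 3 * (C\<^sup>2 * gap 0 ^ 4)"
      using C_pos by (intro mult_left_mono) auto
    also have "\<dots> = 2 / 3 * C ^ 3 * gap 0 ^ 4" by (simp add: power2_eq_square power3_eq_cube)
    finally show ?thesis using mid_distance[of 1 k] by (simp add: add.commute)
  qed
  then show "\<forall>\<^sub>F k in sequentially. norm (mid (k + 1) - mid 1) \<le> 2 / 3 * C ^ 3 * gap 0 ^ 4" by simp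
qed simp

end

end

section \<open>The Gauss composition near a point\<close>

lemma gauss_iterate_0 [simp]: "gauss_iterate A M z 0 = z"
  by (simp add: gauss_iterate_def)

lemma gauss_iterate_Suc:
  "gauss_iterate A M z (Suc n) = (A (gauss_iterate A M z n), M (gauss_iterate A M z n))"
  by (simp add: gauss_iterate_def gauss_step_def)

text \<open>
  Splitting off the first step shows that the iterates depend on the starting pair only through its
  image; this is how the symmetry of the means passes to the limit.
\<close>

lemma gauss_iterate_Suc': "gauss_iterate A M z (Suc n) = gauss_iterate A M (gauss_step A M z) n"
  by (simp add: gauss_iterate_def funpow_swap1)

lemma gauss_composition_eqI:
  "has_gauss_composition W A M z l \<Longrightarrow> gauss_composition W A M z = l"
  unfolding gauss_composition_def
  by (rule the_equality) (auto simp: has_gauss_composition_def intro: LIMSEQ_unique)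

text \<open>
  The iteration is driven by the midpoint estimate; continuity of the means makes the limit continuous.
  The radius \<open>r\<close> is such that the estimate holds for all pairs in the corresponding coordinate ball.
\<close>

locale near_midpoint_pair =
  fixes V :: "'p::t2_space set" and \<phi> :: "'p \<Rightarrow> 'e::real_inner" and base :: 'p
    and W :: "('p \<times> 'p) set" and A M :: "'p \<times> 'p \<Rightarrow> 'p" and r C :: real
  assumes chart: "is_chart (V, \<phi>)" "base \<in> V"
    and r: "r > 0" "cball (\<phi> base) r \<subseteq> \<phi> ` V" "compact (cball (\<phi> base) r)"
    and C: "C > 0"
    and near: "\<And>X Y. \<lbrakk>X \<in> V; Y \<in> V; \<phi> X \<in> cball (\<phi> base) r; \<phi> Y \<in> cball (\<phi> base) r\<rbrakk> \<Longrightarrow>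
      (X, Y) \<in> W \<and> A (X, Y) \<in> V \<and> M (X, Y) \<in> V \<and>
      norm (\<phi> (A (X, Y)) - midpoint (\<phi> X) (\<phi> Y)) \<le> C / 2 * (norm (\<phi> X - \<phi> Y))\<^sup>2 \<and>
      norm (\<phi> (M (X, Y)) - midpoint (\<phi> X) (\<phi> Y)) \<le> C / 2 * (norm (\<phi> X - \<phi> Y))\<^sup>2"
    and cont: "continuous_on W A" "continuous_on W M"
    and sym: "symmetric_on W A" "symmetric_on W M"
    and idem: "idempotent_on W A" "idempotent_on W M"
begin

definition K :: "'p set" where "K = {X \<in> V. \<phi> X \<in> cball (\<phi> base) r}"

definition U :: "'p set" where "U = {X \<in> V. \<phi> X \<in> ball (\<phi> base) (r / 2)}"

definition \<epsilon> :: real where "\<epsilon> = min (1 / (2 * C)) (r / 4)"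

text \<open>
  The gap condition keeps \<open>C \<delta> \<le> 1/2\<close>. Bounding the distance of the midpoint from the base point
  would not give an invariant set, since the midpoint may drift outwards; adding twice the gap
  compensates for the drift.
\<close>

definition D :: "('p \<times> 'p) set" where
  "D = {(X, Y). X \<in> V \<and> Y \<in> V \<and> norm (\<phi> X - \<phi> Y) < \<epsilon> \<and>
     norm (midpoint (\<phi> X) (\<phi> Y) - \<phi> base) + 2 * norm (\<phi> X - \<phi> Y) < r}"

lemma \<epsilon>: "\<epsilon> > 0" "C * \<epsilon> \<le> 1 / 2" "\<epsilon> \<le> r / 4"
proof -
  have "C * \<epsilon> \<le> C * (1 / (2 * C))" unfolding \<epsilon>_def using C by (intro mult_left_mono) auto
  then show "C * \<epsilon> \<le> 1 / 2" using C by simp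
qed (use C r in \<open>auto simp: \<epsilon>_def\<close>)

lemma compact_K: "compact K"
proof -
  have "K = inv_into V \<phi> ` cball (\<phi> base) r"
  proof
    show "K \<subseteq> inv_into V \<phi> ` cball (\<phi> base) r"
    proof
      fix X assume "X \<in> K"
      then show "X \<in> inv_into V \<phi> ` cball (\<phi> base) r"
        using is_chartD(3)[OF chart(1)] by (intro image_eqI[of _ _ "\<phi> X"]) (auto simp: K_def)
    qed
    show "inv_into V \<phi> ` cball (\<phi> base) r \<subseteq> K"
      using r(2) by (auto simp: K_def f_inv_into_f subset_iff inv_into_into)
  qed
  moreover have "continuous_on (cball (\<phi> base) r) (inv_into V \<phi>)"
    using is_chartD(5)[OF chart(1)] r(2) by (rule continuous_on_subset)
  ultimately show ?thesis using r(3) by (simp add: compact_continuous_image)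
qed

lemma K_subset: "K \<subseteq> V" "K \<times> K \<subseteq> W"
  using near by (auto simp: K_def)

lemma U: "open U" "base \<in> U" "U \<subseteq> K"
proof -
  have "open (\<phi> -` ball (\<phi> base) (r / 2) \<inter> V)"
    using is_chartD(1,4)[OF chart(1)] by (simp add: continuous_on_open_vimage)
  moreover have "\<phi> -` ball (\<phi> base) (r / 2) \<inter> V = U" by (auto simp: U_def)
  ultimately show "open U" by simp
  show "base \<in> U" "U \<subseteq> K" using chart(2) r(1) by (auto simp: U_def K_def)
qed

lemma open_D: "open D"
proof -
  have V: "open (V \<times> V)" using is_chartD(1)[OF chart(1)] by (simp add: open_Times)
  have \<phi>: "continuous_on (V \<times> V) (\<lambda>z. \<phi> (fst z))" "continuous_on (V \<times> V) (\<lambda>z. \<phi> (snd z))"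
    by (auto intro!: continuous_on_compose2[OF is_chartD(4)[OF chart(1)]] continuous_intros)
  define f g where "f z = norm (\<phi> (fst z) - \<phi> (snd z))"
    and "g z = norm (midpoint (\<phi> (fst z)) (\<phi> (snd z)) - \<phi> base) + 2 * norm (\<phi> (fst z) - \<phi> (snd z))" for z
  have "continuous_on (V \<times> V) f" "continuous_on (V \<times> V) g"
    unfolding f_def g_def midpoint_def by (intro continuous_intros \<phi>)+
  then have "open (f -` {..<\<epsilon>} \<inter> V \<times> V)" "open (g -` {..<r} \<inter> V \<times> V)"
    using V by (simp_all add: continuous_on_open_vimage)
  then have "open ((f -` {..<\<epsilon>} \<inter> V \<times> V) \<inter> (g -` {..<r} \<inter> V \<times> V))" by (rule open_Int)
  also have "(f -` {..<\<epsilon>} \<inter> V \<times> V) \<inter> (g -` {..<r} \<inter> V \<times> V) = D"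
    by (auto simp: D_def f_def g_def)
  finally show ?thesis .
qed

lemma D_swap: "(X, Y) \<in> D \<Longrightarrow> (Y, X) \<in> D"
  by (auto simp: D_def norm_minus_commute midpoint_sym)

lemma D_subset: "D \<subseteq> K \<times> K"
proof -
  have "X \<in> K" if "(X, Y) \<in> D" for X Y
  proof -
    let ?m = "midpoint (\<phi> X) (\<phi> Y)"
    have "norm (\<phi> X - ?m) = norm (\<phi> X - \<phi> Y) / 2"
      using dist_midpoint(1)[of "\<phi> X" "\<phi> Y"] by (simp add: dist_norm)
    moreover have "norm (\<phi> X - \<phi> base) \<le> norm (\<phi> X - ?m) + norm (?m - \<phi> base)"
      using norm_triangle_ineq[of "\<phi> X - ?m" "?m - \<phi> base"] by simp
    moreover have "norm (?m - \<phi> base) + 2 * norm (\<phi> X - \<phi> Y) < r" using that by (simp add: D_def)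
    ultimately have "norm (\<phi> X - \<phi> base) \<le> r" using norm_ge_zero[of "\<phi> X - \<phi> Y"] by linarith
    then show ?thesis using that by (simp add: D_def K_def dist_norm norm_minus_commute)
  qed
  then show ?thesis using D_swap by auto
qed

lemma D_W: "z \<in> D \<Longrightarrow> z \<in> W"
  using D_subset K_subset by blast

lemma D_near:
  assumes "(X, Y) \<in> D"
  shows "A (X, Y) \<in> V" "M (X, Y) \<in> V"
    "norm (\<phi> (A (X, Y)) - midpoint (\<phi> X) (\<phi> Y)) \<le> C / 2 * (norm (\<phi> X - \<phi> Y))\<^sup>2"
    "norm (\<phi> (M (X, Y)) - midpoint (\<phi> X) (\<phi> Y)) \<le> C / 2 * (norm (\<phi> X - \<phi> Y))\<^sup>2"
  using near[of X Y] assms D_subset by (auto simp: K_def)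

lemma D_gap: "(X, Y) \<in> D \<Longrightarrow> C * norm (\<phi> X - \<phi> Y) \<le> 1 / 2"
proof -
  assume "(X, Y) \<in> D"
  then have "C * norm (\<phi> X - \<phi> Y) \<le> C * \<epsilon>" using C by (intro mult_left_mono) (auto simp: D_def)
  then show ?thesis using \<epsilon>(2) by linarith
qed

text \<open>
  The midpoint moves by at most \<open>(C/2) \<delta>\<^sup>2 \<le> \<delta>/4\<close> and the new gap is at most \<open>\<delta>/2\<close>, so the sum in
  the definition of \<open>D\<close> does not increase.
\<close>

lemma D_step:
  assumes "(X, Y) \<in> D"
  shows "gauss_step A M (X, Y) \<in> D"
proof -
  let ?m = "midpoint (\<phi> X) (\<phi> Y)" and ?m' = "midpoint (\<phi> (A (X, Y))) (\<phi> (M (X, Y)))"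
  note s = near_midpoint_step[OF C D_gap[OF assms] D_near(3,4)[OF assms]]
  have "norm (?m' - \<phi> base) \<le> norm (?m' - ?m) + norm (?m - \<phi> base)"
    using norm_triangle_ineq[of "?m' - ?m" "?m - \<phi> base"] by simp
  moreover have "norm (\<phi> X - \<phi> Y) < \<epsilon>" "norm (?m - \<phi> base) + 2 * norm (\<phi> X - \<phi> Y) < r"
    using assms by (auto simp: D_def)
  ultimately have "norm (\<phi> (A (X, Y)) - \<phi> (M (X, Y))) < \<epsilon>"
    "norm (?m' - \<phi> base) + 2 * norm (\<phi> (A (X, Y)) - \<phi> (M (X, Y))) < r"
    using s(1,2,4) norm_ge_zero[of "\<phi> X - \<phi> Y"] by linarith+
  then show ?thesis using D_near(1,2)[OF assms] by (simp add: D_def gauss_step_def)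
qed

text \<open>
  Here \<open>\<epsilon> \<le> r/4\<close> is used: the midpoint is within \<open>r/2\<close> of the base point, and twice the gap is below
  \<open>r/2\<close>.
\<close>

lemma near_diagonal_subset_D: "{(X, Y). X \<in> U \<and> Y \<in> U \<and> norm (\<phi> X - \<phi> Y) < \<epsilon>} \<subseteq> D"
proof clarify
  fix X Y assume XY: "X \<in> U" "Y \<in> U" "norm (\<phi> X - \<phi> Y) < \<epsilon>"
  have "midpoint (\<phi> X) (\<phi> Y) \<in> ball (\<phi> base) (r / 2)"
    using XY(1,2) convexD_alt[OF convex_ball, of "\<phi> X" "\<phi> base" "r / 2" "\<phi> Y" "1 / 2"]
    by (simp add: U_def midpoint_def algebra_simps)
  then show "(X, Y) \<in> D"
    using XY \<epsilon>(3) by (simp add: D_def U_def dist_norm norm_minus_commute[of "\<phi> base"])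
qed

lemma iterate_D: "z \<in> D \<Longrightarrow> gauss_iterate A M z n \<in> D"
proof (induction n)
  case (Suc n)
  then have "gauss_step A M (gauss_iterate A M z n) \<in> D"
    by (metis D_step surj_pair)
  then show ?case by (simp add: gauss_iterate_Suc gauss_step_def)
qed simp

lemma iterate_K:
  assumes "z \<in> D"
  shows "fst (gauss_iterate A M z n) \<in> K" "snd (gauss_iterate A M z n) \<in> K"
  using D_subset iterate_D[OF assms, of n] by (auto simp: mem_Times_iff)

abbreviation P where "P z n \<equiv> fst (gauss_iterate A M z n)"

abbreviation Q where "Q z n \<equiv> snd (gauss_iterate A M z n)"

abbreviation L where "L \<equiv> gauss_composition W A M"

lemma iterate_sequences:
  assumes "z \<in> D"
  shows "near_midpoint_sequences (\<lambda>n. \<phi> (P z n)) (\<lambda>n. \<phi> (Q z n)) C"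
proof
  have PQ: "(P z n, Q z n) \<in> D" for n using iterate_D[OF assms] by simp
  show "C * norm (\<phi> (P z 0) - \<phi> (Q z 0)) \<le> 1 / 2" by (rule D_gap[OF PQ])
  show "norm (\<phi> (P z (Suc n)) - midpoint (\<phi> (P z n)) (\<phi> (Q z n)))
      \<le> C / 2 * (norm (\<phi> (P z n) - \<phi> (Q z n)))\<^sup>2" for n
    using D_near(3)[OF PQ] by (simp add: gauss_iterate_Suc)
  show "norm (\<phi> (Q z (Suc n)) - midpoint (\<phi> (P z n)) (\<phi> (Q z n)))
      \<le> C / 2 * (norm (\<phi> (P z n) - \<phi> (Q z n)))\<^sup>2" for n
    using D_near(4)[OF PQ] by (simp add: gauss_iterate_Suc)
qed (rule C)

text \<open>
  The coordinate sequence is Cauchy in a compact ball, hence converges there. Its limit is brought back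
  to the manifold by the continuous inverse of the chart.
\<close>

lemma composition:
  assumes "z \<in> D"
  shows "has_gauss_composition W A M z (L z)" "L z \<in> K" "(\<lambda>n. \<phi> (P z n)) \<longlonglongrightarrow> \<phi> (L z)"
proof -
  interpret near_midpoint_sequences "\<lambda>n. \<phi> (P z n)" "\<lambda>n. \<phi> (Q z n)" C
    using assms by (rule iterate_sequences)
  note PQ = iterate_K[OF assms]
  have "\<forall>n. \<phi> (P z n) \<in> cball (\<phi> base) r" using PQ(1) by (simp add: K_def)
  then obtain x where x: "x \<in> cball (\<phi> base) r" "(\<lambda>n. \<phi> (P z n)) \<longlonglongrightarrow> x"
    using completeE[OF compact_imp_complete[OF r(3)] _ Cauchy_p] by metis
  then obtain l where l: "l \<in> V" "\<phi> l = x" using r(2) by auto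
  have lim: "f \<longlonglongrightarrow> l" if f: "\<And>n. f n \<in> K" "(\<lambda>n. \<phi> (f n)) \<longlonglongrightarrow> x" for f :: "nat \<Rightarrow> 'p"
  proof -
    have "(\<lambda>n. inv_into V \<phi> (\<phi> (f n))) \<longlonglongrightarrow> inv_into V \<phi> x"
      using l f K_subset(1)
      by (intro continuous_on_tendsto_compose[OF is_chartD(5)[OF chart(1)]])
        (auto intro!: always_eventually)
    moreover have "inv_into V \<phi> (\<phi> (f n)) = f n" for n
      using inv_into_f_f[OF is_chartD(3)[OF chart(1)]] f(1)[of n] K_subset(1) by blast
    moreover have "inv_into V \<phi> x = l"
      using l is_chartD(3)[OF chart(1)] by (auto simp: inv_into_f_f)
    ultimately show ?thesis by simp
  qed
  have has: "has_gauss_composition W A M z l"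
    using lim[OF PQ(1) x(2)] lim[OF PQ(2) q_tendsto[OF x(2)]] iterate_D[OF assms] D_W
    by (simp add: has_gauss_composition_def)
  then have "L z = l" by (rule gauss_composition_eqI)
  then show "has_gauss_composition W A M z (L z)" "L z \<in> K" "(\<lambda>n. \<phi> (P z n)) \<longlonglongrightarrow> \<phi> (L z)"
    using has x l by (auto simp: K_def)
qed

lemma continuous_on_iterate: "continuous_on D (\<lambda>z. gauss_iterate A M z n)"
proof (induction n)
  case (Suc n)
  show ?case
    unfolding gauss_iterate_Suc using D_W[OF iterate_D]
    by (intro continuous_intros continuous_on_compose2[OF cont(1) Suc]
        continuous_on_compose2[OF cont(2) Suc]) blast+
qed (simp add: continuous_on_id)

text \<open>
  Since all initial gaps are below \<open>\<epsilon>\<close>, the \<open>n\<close>-th iterate is within \<open>2 \<epsilon> / 2 ^ n\<close> of the limit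
  in coordinates, uniformly on \<open>D\<close>.
\<close>

lemma continuous_on_composition: "continuous_on D L"
proof -
  have bound: "dist (\<phi> (P z n)) (\<phi> (L z)) \<le> 2 * (\<epsilon> / 2 ^ n)" if z: "z \<in> D" for z n
  proof -
    interpret near_midpoint_sequences "\<lambda>n. \<phi> (P z n)" "\<lambda>n. \<phi> (Q z n)" C
      using z by (rule iterate_sequences)
    have "gap 0 \<le> \<epsilon>" using z by (auto simp: D_def)
    then have "gap n \<le> \<epsilon> / 2 ^ n"
      using gap_geometric[of n] divide_right_mono[of "gap 0" \<epsilon> "2 ^ n"] by simp
    then show ?thesis using p_limit_distance[OF composition(3)[OF z], of n] by (simp add: dist_norm)
  qed
  have "(\<lambda>n. 2 * (\<epsilon> / 2 ^ n)) \<longlonglongrightarrow> 0"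
    using tendsto_mult_right[OF LIMSEQ_power_zero[of "1/2::real"], of "2 * \<epsilon>"]
    by (simp add: power_divide)
  then have small: "\<forall>\<^sub>F n in sequentially. 2 * (\<epsilon> / 2 ^ n) < e" if "e > 0" for e
    using that by (rule order_tendstoD(2))
  have "uniform_limit D (\<lambda>n z. \<phi> (P z n)) (\<lambda>z. \<phi> (L z)) sequentially"
  proof (rule uniform_limitI)
    fix e :: real assume "e > 0"
    from small[OF this] show "\<forall>\<^sub>F n in sequentially. \<forall>z\<in>D. dist (\<phi> (P z n)) (\<phi> (L z)) < e"
      by eventually_elim (use bound in \<open>auto intro: le_less_trans\<close>)
  qed
  moreover have "continuous_on D (\<lambda>z. \<phi> (P z n))" for n
    using iterate_K(1) K_subset(1)
    by (intro continuous_on_compose2[OF is_chartD(4)[OF chart(1)]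
          continuous_on_fst[OF continuous_on_iterate]]) blast
  ultimately have "continuous_on D (\<lambda>z. \<phi> (L z))"
    by (intro uniform_limit_theorem[of _ _ sequentially]) auto
  then have "continuous_on D (\<lambda>z. inv_into V \<phi> (\<phi> (L z)))"
    using composition(2) K_subset(1)
    by (intro continuous_on_compose2[OF is_chartD(5)[OF chart(1)]]) auto
  moreover have "inv_into V \<phi> (\<phi> (L z)) = L z" if "z \<in> D" for z
    using composition(2)[OF that] K_subset(1) is_chartD(3)[OF chart(1)] by (auto simp: inv_into_f_f)
  ultimately show ?thesis by (simp cong: continuous_on_cong)
qed

text \<open>
  The iterations started at \<open>(X, Y)\<close> and \<open>(Y, X)\<close> agree from the first step on.
\<close>

lemma symmetric_on_composition: "symmetric_on D L"
  unfolding symmetric_on_def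
proof (intro allI impI, elim conjE)
  fix X Y assume XY: "(X, Y) \<in> D" "(Y, X) \<in> D"
  have "gauss_step A M (X, Y) = gauss_step A M (Y, X)"
    using XY[THEN D_W] sym by (auto simp: gauss_step_def symmetric_on_def)
  then have "P (X, Y) (Suc n) = P (Y, X) (Suc n)" for n by (simp add: gauss_iterate_Suc')
  moreover have "(\<lambda>n. P z (Suc n)) \<longlonglongrightarrow> L z" if "z \<in> D" for z
    using composition(1)[OF that] by (auto simp: has_gauss_composition_def intro: LIMSEQ_Suc)
  ultimately show "L (X, Y) = L (Y, X)" using XY by (metis (no_types, lifting) LIMSEQ_unique ext)
qed

lemma idempotent_on_composition: "idempotent_on D L"
  unfolding idempotent_on_def
proof (intro allI impI)
  fix X assume X: "(X, X) \<in> D"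
  have "gauss_iterate A M (X, X) n = (X, X)" for n
    using D_W[OF X] idem by (induction n) (auto simp: gauss_iterate_Suc idempotent_on_def)
  then show "L (X, X) = X"
    using D_W[OF X] by (intro gauss_composition_eqI) (simp add: has_gauss_composition_def)
qed

lemma composition_near_mean_of_means:
  assumes "(X, Y) \<in> D"
  shows "norm (\<phi> (L (X, Y)) - (\<phi> (A (X, Y)) + \<phi> (M (X, Y))) /\<^sub>R 2)
    \<le> 2 / 3 * C ^ 3 * norm (\<phi> X - \<phi> Y) ^ 4"
  using near_midpoint_sequences.limit_near_second_midpoint[OF iterate_sequences[OF assms] composition(3)[OF assms]]
  by (simp add: gauss_iterate_Suc midpoint_def)

lemma iterate_estimates:
  assumes "z \<in> D"
  shows "norm (\<phi> (P z (Suc n)) - \<phi> (Q z (Suc n))) \<le> C * (norm (\<phi> (P z n) - \<phi> (Q z n)))\<^sup>2"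
    "C * (norm (\<phi> (P z n) - \<phi> (Q z n)))\<^sup>2 \<le> norm (\<phi> (P z n) - \<phi> (Q z n)) / 2"
    "norm (\<phi> (P z n) - \<phi> (L z)) \<le> 2 * norm (\<phi> (P z n) - \<phi> (Q z n))"
    "norm (\<phi> (Q z n) - \<phi> (L z)) \<le> 3 * norm (\<phi> (P z n) - \<phi> (Q z n))"
proof -
  interpret near_midpoint_sequences "\<lambda>n. \<phi> (P z n)" "\<lambda>n. \<phi> (Q z n)" C
    using assms by (rule iterate_sequences)
  show "norm (\<phi> (P z (Suc n)) - \<phi> (Q z (Suc n))) \<le> C * (norm (\<phi> (P z n) - \<phi> (Q z n)))\<^sup>2"
    "C * (norm (\<phi> (P z n) - \<phi> (Q z n)))\<^sup>2 \<le> norm (\<phi> (P z n) - \<phi> (Q z n)) / 2"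
    by (rule step)+
  show "norm (\<phi> (P z n) - \<phi> (L z)) \<le> 2 * norm (\<phi> (P z n) - \<phi> (Q z n))"
    "norm (\<phi> (Q z n) - \<phi> (L z)) \<le> 3 * norm (\<phi> (P z n) - \<phi> (Q z n))"
    using composition(3)[OF assms] by (rule p_limit_distance q_limit_distance)+
qed

end

theorem theorem3p2:
  fixes \<A> :: "('p::{t2_space, second_countable_topology}, 'e::real_inner) chart set"
    and base :: 'p
    and W :: "('p \<times> 'p) set"
    and A M :: "'p \<times> 'p \<Rightarrow> 'p"
    and V :: "'p set"
    and \<phi> :: "'p \<Rightarrow> 'e"
  assumes manifold: "smooth_manifold \<A>"
    and W: "open W" "(base, base) \<in> W"
    and A: "Ck_map 2 (product_atlas \<A> \<A>) \<A> W A" "symmetric_on W A" "idempotent_on W A"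
    and M: "Ck_map 2 (product_atlas \<A> \<A>) \<A> W M" "symmetric_on W M" "idempotent_on W M"
    and chart: "(V, \<phi>) \<in> coordinate_charts \<A>" "base \<in> V"
  shows "\<exists>K U D \<epsilon> C.
    compact K \<and> K \<subseteq> V \<and> K \<times> K \<subseteq> W \<and>
    open U \<and> base \<in> U \<and> U \<subseteq> K \<and>
    open D \<and> (\<forall>X Y. (X, Y) \<in> D \<longrightarrow> (Y, X) \<in> D) \<and>
    gauss_step A M ` D \<subseteq> D \<and> D \<subseteq> K \<times> K \<and>
    0 < \<epsilon> \<and> 0 < C \<and>
    {(X, Y). X \<in> U \<and> Y \<in> U \<and> norm (\<phi> X - \<phi> Y) < \<epsilon>} \<subseteq> D \<and>
    (\<forall>z\<in>D.
      let P = (\<lambda>n. fst (gauss_iterate A M z n));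
          Q = (\<lambda>n. snd (gauss_iterate A M z n));
          \<delta> = (\<lambda>n. norm (\<phi> (P n) - \<phi> (Q n)));
          l = gauss_composition W A M z
      in (\<forall>n. (P n, Q n) \<in> D \<and> \<delta> (Suc n) \<le> C * (\<delta> n)\<^sup>2 \<and> C * (\<delta> n)\<^sup>2 \<le> \<delta> n / 2) \<and>
         has_gauss_composition W A M z l \<and> l \<in> K \<and>
         (\<forall>n. norm (\<phi> (P n) - \<phi> l) \<le> 2 * \<delta> n \<and> norm (\<phi> (Q n) - \<phi> l) \<le> 3 * \<delta> n)) \<and>
    continuous_on D (gauss_composition W A M) \<and>
    symmetric_on D (gauss_composition W A M) \<and>
    idempotent_on D (gauss_composition W A M) \<and>
    (\<forall>X Y. (X, Y) \<in> D \<longrightarrow>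
      norm (\<phi> (gauss_composition W A M (X, Y)) - (\<phi> (A (X, Y)) + \<phi> (M (X, Y))) /\<^sub>R 2)
        \<le> 2 / 3 * C ^ 3 * norm (\<phi> X - \<phi> Y) ^ 4)"
proof -
  obtain B :: "'e set" where B: "finite B" "span B = UNIV"
    using manifold by (auto simp: smooth_manifold_def)
  have \<phi>: "is_chart (V, \<phi>)" using chart(1) by (simp add: coordinate_charts_def)
  obtain CA where CA: "CA > 0" "\<forall>\<^sub>F (X, Y) in nhds (base, base). X \<in> V \<and> Y \<in> V \<and> (X, Y) \<in> W \<and> A (X, Y) \<in> V \<and>
      norm (\<phi> (A (X, Y)) - midpoint (\<phi> X) (\<phi> Y)) \<le> CA * (norm (\<phi> X - \<phi> Y))\<^sup>2"
    using mean_near_midpoint[OF manifold W A chart] by blast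
  obtain CM where CM: "CM > 0" "\<forall>\<^sub>F (X, Y) in nhds (base, base). X \<in> V \<and> Y \<in> V \<and> (X, Y) \<in> W \<and> M (X, Y) \<in> V \<and>
      norm (\<phi> (M (X, Y)) - midpoint (\<phi> X) (\<phi> Y)) \<le> CM * (norm (\<phi> X - \<phi> Y))\<^sup>2"
    using mean_near_midpoint[OF manifold W M chart] by blast
  define C where "C = 2 * max CA CM"
  have C: "C > 0" "CA \<le> C / 2" "CM \<le> C / 2" using CA(1) by (auto simp: C_def)
  define good where "good X Y \<longleftrightarrow> (X, Y) \<in> W \<and> A (X, Y) \<in> V \<and> M (X, Y) \<in> V \<and>
      norm (\<phi> (A (X, Y)) - midpoint (\<phi> X) (\<phi> Y)) \<le> C / 2 * (norm (\<phi> X - \<phi> Y))\<^sup>2 \<and>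
      norm (\<phi> (M (X, Y)) - midpoint (\<phi> X) (\<phi> Y)) \<le> C / 2 * (norm (\<phi> X - \<phi> Y))\<^sup>2" for X Y
  have "\<forall>\<^sub>F z in nhds (base, base). good (fst z) (snd z)"
    using CA(2) CM(2)
  proof eventually_elim
    case (elim z)
    then show ?case
      using mult_right_mono[OF C(2), of "(norm (\<phi> (fst z) - \<phi> (snd z)))\<^sup>2"]
        mult_right_mono[OF C(3), of "(norm (\<phi> (fst z) - \<phi> (snd z)))\<^sup>2"]
      by (auto simp: good_def)
  qed
  then obtain G where G: "eventually G (nhds base)" "\<And>X Y. G X \<Longrightarrow> G Y \<Longrightarrow> good X Y"
    by (auto simp: nhds_prod eventually_prod_same)
  then obtain N where N: "open N" "base \<in> N" "\<And>X. X \<in> N \<Longrightarrow> G X" by (auto simp: eventually_nhds)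
  have "open (\<phi> ` (N \<inter> V))"
    using N(1) is_chartD(1)[OF \<phi>] by (intro chart_image_open[OF \<phi>]) auto
  moreover have "\<phi> base \<in> \<phi> ` (N \<inter> V)" using N(2) chart(2) by simp
  ultimately obtain r where r: "r > 0" "cball (\<phi> base) r \<subseteq> \<phi> ` (N \<inter> V)"
    using open_contains_cball by metis
  have inN: "X \<in> N" if "X \<in> V" "\<phi> X \<in> cball (\<phi> base) r" for X
    using that r(2) is_chartD(3)[OF \<phi>] by (auto simp: subset_iff inj_on_def)
  interpret near_midpoint_pair V \<phi> base W A M r C
  proof
    show "cball (\<phi> base) r \<subseteq> \<phi> ` V" using r(2) by auto
    show "compact (cball (\<phi> base) r)" using B by (rule compact_cball_finite_span)
    show "continuous_on W A" "continuous_on W M" using A(1) M(1) by (auto simp: Ck_map_def)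
  qed (use \<phi> chart(2) r(1) C(1) A(2,3) M(2,3) G(2) N(3) inN in \<open>auto simp: good_def\<close>)
  show ?thesis
  proof (rule exI[of _ K], rule exI[of _ U], rule exI[of _ D], rule exI[of _ \<epsilon>], rule exI[of _ C],
      intro conjI ballI allI impI)
    fix z assume z: "z \<in> D"
    show "let P = (\<lambda>n. fst (gauss_iterate A M z n));
          Q = (\<lambda>n. snd (gauss_iterate A M z n));
          \<delta> = (\<lambda>n. norm (\<phi> (P n) - \<phi> (Q n)));
          l = gauss_composition W A M z
      in (\<forall>n. (P n, Q n) \<in> D \<and> \<delta> (Suc n) \<le> C * (\<delta> n)\<^sup>2 \<and> C * (\<delta> n)\<^sup>2 \<le> \<delta> n / 2) \<and>
         has_gauss_composition W A M z l \<and> l \<in> K \<and>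
         (\<forall>n. norm (\<phi> (P n) - \<phi> l) \<le> 2 * \<delta> n \<and> norm (\<phi> (Q n) - \<phi> l) \<le> 3 * \<delta> n)"
      unfolding Let_def
      by (intro conjI allI iterate_estimates[OF z] composition[OF z]) (simp add: iterate_D[OF z])
  next
    show "gauss_step A M ` D \<subseteq> D" using D_step by force
  qed (fact compact_K K_subset U open_D D_subset \<epsilon>(1) C(1) near_diagonal_subset_D
      continuous_on_composition symmetric_on_composition idempotent_on_composition |
      erule D_swap composition_near_mean_of_means)+
qed

end
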